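(* Let $F$ be an algebraically closed field, let $V$ be an $F$-vector space, and let $A=(V,\bullet)$ and $B=(V,\circ)$ be two associative algebra structures on $V$, where $B$ is semisimple. Let $(V,\succ,\prec)$ be a post-associative algebra structure on $(A,B)$, and let $R$ be a Rota--Baxter operator of weight $1$ on $B$ from which it arises, i.e. $x\succ y=R(x)\circ y$ and $x\prec y=x\circ R(y)$ for all $x,y\in V$ (such an $R$ exists because $B$ is semisimple). Let $A_i=(V,\bullet_i)$, $i\ge 0$, be the associated sequence of associative algebras. Then $A_i$ is not nilpotent for all $i\ge 0$.
   Context: Algebras are finite-dimensional. A semisimple associative algebra is a nonzero algebra with zero Jacobson radical. Given two associative products $A=(V,\bullet)$ and $B=(V,\circ)$ on the same $F$-vector space $V$, a post-associative algebra structure on the pair $(A,B)$ is a pair of $F$-bilinear products $\succ,\prec$ on $V$ such that for all $x,y,z\in V$: (1) $x\bullet y-x\circ y=x\succ y+x\prec y$; (2) $(x\bullet y)\succ z=x\succ(y\succ z)$; (3) $x\prec(y\bullet z)=(x\prec y)\prec z$; (4) $x\succ(y\circ z)=(x\succ y)\circ z$; (5) $(x\circ y)\prec z=x\circ(y\prec z)$; (6) $(x\prec y)\circ z=x\circ(y\succ z)$. A Rota--Baxter operator of weight $1$ on $B$ is a linear map $R\colon B\to B$ with $R(x)\circ R(y)=R\bigl(R(x)\circ y+x\circ R(y)+x\circ y\bigr)$ for all $x,y\in B$. The associated sequence of associative products on $V$ is defined by $x\bullet_0 y=x\circ y$ and $x\bullet_{i+1}y=R(x)\bullet_i y+x\bullet_i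 R(y)+x\bullet_i y$ for $i\ge0$, and $A_i=(V,\bullet_i)$. Thus $A_0=B$ and $A_1=A$. *)

theory Defs
  imports "HOL-Computational_Algebra.Polynomial"
begin

text \<open>
  The vector space \<open>V\<close> is the whole type \<open>'v\<close>, with scalar multiplication \<open>scale\<close> over the
  field \<open>'f\<close>; an algebra is given by \<open>scale\<close> and a product on \<open>'v\<close>. Algebras are not assumed
  to be unital.
\<close>

definition finite_dimensional :: "('f::field \<Rightarrow> 'v::ab_group_add \<Rightarrow> 'v) \<Rightarrow> bool" where
  "finite_dimensional scale \<longleftrightarrow> (\<exists>Basis. finite_dimensional_vector_space scale Basis)"

definition bilinear_product ::
  "('f::field \<Rightarrow> 'v::ab_group_add \<Rightarrow> 'v) \<Rightarrow> ('v \<Rightarrow> 'v \<Rightarrow> 'v) \<Rightarrow> bool" where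
  "bilinear_product scale mul \<longleftrightarrow>
     (\<forall>x. Vector_Spaces.linear scale scale (\<lambda>y. mul x y)) \<and>
     (\<forall>y. Vector_Spaces.linear scale scale (\<lambda>x. mul x y))"

definition associative_algebra ::
  "('f::field \<Rightarrow> 'v::ab_group_add \<Rightarrow> 'v) \<Rightarrow> ('v \<Rightarrow> 'v \<Rightarrow> 'v) \<Rightarrow> bool" where
  "associative_algebra scale mul \<longleftrightarrow>
     finite_dimensional scale \<and> bilinear_product scale mul \<and>
     (\<forall>x y z. mul (mul x y) z = mul x (mul y z))"

definition left_ideal ::
  "('f::field \<Rightarrow> 'v::ab_group_add \<Rightarrow> 'v) \<Rightarrow> ('v \<Rightarrow> 'v \<Rightarrow> 'v) \<Rightarrow> 'v set \<Rightarrow> bool" where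
  "left_ideal scale mul L \<longleftrightarrow>
     module.subspace scale L \<and> (\<forall>a. \<forall>x\<in>L. mul a x \<in> L)"

text \<open>
  Modular (also called regular) left ideals: \<open>e\<close> is a right unit modulo \<open>L\<close>. In a unital algebra
  every left ideal is modular.
\<close>

definition modular_left_ideal ::
  "('f::field \<Rightarrow> 'v::ab_group_add \<Rightarrow> 'v) \<Rightarrow> ('v \<Rightarrow> 'v \<Rightarrow> 'v) \<Rightarrow> 'v set \<Rightarrow> bool" where
  "modular_left_ideal scale mul L \<longleftrightarrow>
     left_ideal scale mul L \<and> (\<exists>e. \<forall>x. x - mul x e \<in> L)"

definition maximal_modular_left_ideal ::
  "('f::field \<Rightarrow> 'v::ab_group_add \<Rightarrow> 'v) \<Rightarrow> ('v \<Rightarrow> 'v \<Rightarrow> 'v) \<Rightarrow> 'v set \<Rightarrow> bool" where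
  "maximal_modular_left_ideal scale mul L \<longleftrightarrow>
     modular_left_ideal scale mul L \<and> L \<noteq> UNIV \<and>
     (\<forall>M. left_ideal scale mul M \<and> L \<subseteq> M \<longrightarrow> M = L \<or> M = UNIV)"

text \<open>
  The Jacobson radical of a not necessarily unital algebra. If there is no maximal modular left
  ideal, the intersection is the whole algebra, as in the usual convention.
\<close>

definition jacobson_radical ::
  "('f::field \<Rightarrow> 'v::ab_group_add \<Rightarrow> 'v) \<Rightarrow> ('v \<Rightarrow> 'v \<Rightarrow> 'v) \<Rightarrow> 'v set" where
  "jacobson_radical scale mul = \<Inter> {L. maximal_modular_left_ideal scale mul L}"

definition semisimple_algebra ::
  "('f::field \<Rightarrow> 'v::ab_group_add \<Rightarrow> 'v) \<Rightarrow> ('v \<Rightarrow> 'v \<Rightarrow> 'v) \<Rightarrow> bool" where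
  "semisimple_algebra scale mul \<longleftrightarrow>
     associative_algebra scale mul \<and> (\<exists>x::'v. x \<noteq> 0) \<and> jacobson_radical scale mul = {0}"

text \<open>
  The index is shifted by one: \<open>algebra_power scale mul n\<close> is the power with exponent \<open>n + 1\<close>,
  so index \<open>0\<close> gives the algebra itself.
\<close>

primrec algebra_power ::
  "('f::field \<Rightarrow> 'v::ab_group_add \<Rightarrow> 'v) \<Rightarrow> ('v \<Rightarrow> 'v \<Rightarrow> 'v) \<Rightarrow> nat \<Rightarrow> 'v set" where
  "algebra_power scale mul 0 = UNIV"
| "algebra_power scale mul (Suc n) =
     module.span scale {mul x y | x y. x \<in> algebra_power scale mul n}"

definition nilpotent_algebra ::
  "('f::field \<Rightarrow> 'v::ab_group_add \<Rightarrow> 'v) \<Rightarrow> ('v \<Rightarrow> 'v \<Rightarrow> 'v) \<Rightarrow> bool" where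
  "nilpotent_algebra scale mul \<longleftrightarrow> (\<exists>n. algebra_power scale mul n = {0})"

text \<open>
  The product arguments are, in order, those of \<open>A\<close> and \<open>B\<close>, followed by the two products of the
  post-associative structure.
\<close>

definition post_associative_structure ::
  "('f::field \<Rightarrow> 'v::ab_group_add \<Rightarrow> 'v) \<Rightarrow> ('v \<Rightarrow> 'v \<Rightarrow> 'v) \<Rightarrow> ('v \<Rightarrow> 'v \<Rightarrow> 'v) \<Rightarrow>
   ('v \<Rightarrow> 'v \<Rightarrow> 'v) \<Rightarrow> ('v \<Rightarrow> 'v \<Rightarrow> 'v) \<Rightarrow> bool" where
  "post_associative_structure scale mulA mulB succ prec \<longleftrightarrow>
     associative_algebra scale mulA \<and> associative_algebra scale mulB \<and>
     bilinear_product scale succ \<and> bilinear_product scale prec \<and>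
     (\<forall>x y z.
        mulA x y - mulB x y = succ x y + prec x y \<and>
        succ (mulA x y) z = succ x (succ y z) \<and>
        prec x (mulA y z) = prec (prec x y) z \<and>
        succ x (mulB y z) = mulB (succ x y) z \<and>
        prec (mulB x y) z = mulB x (prec y z) \<and>
        mulB (prec x y) z = mulB x (succ y z))"

definition rota_baxter_operator_weight_1 ::
  "('f::field \<Rightarrow> 'v::ab_group_add \<Rightarrow> 'v) \<Rightarrow> ('v \<Rightarrow> 'v \<Rightarrow> 'v) \<Rightarrow> ('v \<Rightarrow> 'v) \<Rightarrow> bool" where
  "rota_baxter_operator_weight_1 scale mul R \<longleftrightarrow>
     Vector_Spaces.linear scale scale R \<and>
     (\<forall>x y. mul (R x) (R y) = R (mul (R x) y + mul x (R y) + mul x y))"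

primrec associated_product ::
  "('v::ab_group_add \<Rightarrow> 'v \<Rightarrow> 'v) \<Rightarrow> ('v \<Rightarrow> 'v) \<Rightarrow> nat \<Rightarrow> 'v \<Rightarrow> 'v \<Rightarrow> 'v" where
  "associated_product mul R 0 = mul"
| "associated_product mul R (Suc i) =
     (\<lambda>x y. associated_product mul R i (R x) y + associated_product mul R i x (R y)
          + associated_product mul R i x y)"

end

theory Submission
  imports Defs
begin

text \<open>
  If \<open>R\<close> is a Rota--Baxter operator of weight \<open>1\<close> on \<open>A\<^sub>i\<close>, then it is one on \<open>A\<^sub>i\<^sub>+\<^sub>1\<close> as well,
  and both \<open>R\<close> and \<open>R + id\<close> are homomorphisms from \<open>A\<^sub>i\<^sub>+\<^sub>1\<close> to \<open>A\<^sub>i\<close>. Since \<open>x = (R x + x) - R x\<close>,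
  the algebra \<open>A\<^sub>i\<close> is the sum of two homomorphic images of \<open>A\<^sub>i\<^sub>+\<^sub>1\<close>. By Kegel's theorem a sum
  of two nilpotent subalgebras is nilpotent, so nilpotency of \<open>A\<^sub>i\<^sub>+\<^sub>1\<close> would descend to
  \<open>A\<^sub>0 = B\<close>; but in a nilpotent algebra no proper left ideal is modular, so its radical is
  everything.

  Kegel's theorem for finite-dimensional algebras: let \<open>U\<close> be a nonzero right ideal of
  \<open>C = N\<^sub>1 + N\<^sub>2\<close> and \<open>J\<close> maximal among the right ideals properly contained in \<open>U\<close>. As \<open>N\<^sub>1\<close> is
  nilpotent, some \<open>v \<in> U - J\<close> satisfies \<open>v N\<^sub>1 \<subseteq> J\<close>. If \<open>J + v C = U\<close> then \<open>v \<in> J + v b\<close> for some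
  \<open>b \<in> N\<^sub>2\<close>, and nilpotency of \<open>b\<close> yields \<open>v \<in> J\<close>. Hence \<open>v C \<subseteq> J\<close>, so by maximality \<open>U C \<subseteq> J\<close>,
  and one concludes by induction on \<open>dim U\<close>.
\<close>

section \<open>Algebra identities and right ideals\<close>

lemma associative_algebra_simps:
  assumes "associative_algebra scale mul"
  shows "mul (x + y) z = mul x z + mul y z" "mul x (y + z) = mul x y + mul x z"
    "mul (x - y) z = mul x z - mul y z" "mul x (y - z) = mul x y - mul x z"
    "mul (scale c x) y = scale c (mul x y)" "mul x (scale c y) = scale c (mul x y)"
    "mul 0 x = 0" "mul x 0 = 0"
    "mul (mul x y) z = mul x (mul y z)"
proof -
  have l: "module_hom scale scale (\<lambda>y. mul x y)" and r: "module_hom scale scale (\<lambda>x. mul x y)" for x y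
    using assms unfolding associative_algebra_def bilinear_product_def
      Vector_Spaces.linear_def by auto
  note L = module_hom.add[OF l] module_hom.diff[OF l] module_hom.scale[OF l] module_hom.zero[OF l]
  note R = module_hom.add[OF r] module_hom.diff[OF r] module_hom.scale[OF r] module_hom.zero[OF r]
  show "mul (x + y) z = mul x z + mul y z" "mul x (y + z) = mul x y + mul x z"
    "mul (x - y) z = mul x z - mul y z" "mul x (y - z) = mul x y - mul x z"
    "mul (scale c x) y = scale c (mul x y)" "mul x (scale c y) = scale c (mul x y)"
    "mul 0 x = 0" "mul x 0 = 0"
    by (rule L R)+
  show "mul (mul x y) z = mul x (mul y z)"
    using assms unfolding associative_algebra_def by blast
qed

lemma associative_algebra_module:
  "associative_algebra scale mul \<Longrightarrow> module scale"
  unfolding associative_algebra_def finite_dimensional_def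
    finite_dimensional_vector_space_def vector_space_def module_def
  by blast

definition right_ideal ::
  "('f::field \<Rightarrow> 'v::ab_group_add \<Rightarrow> 'v) \<Rightarrow> ('v \<Rightarrow> 'v \<Rightarrow> 'v) \<Rightarrow> 'v set \<Rightarrow> bool" where
  "right_ideal scale mul U \<longleftrightarrow> module.subspace scale U \<and> (\<forall>x\<in>U. \<forall>a. mul x a \<in> U)"

lemma right_ideal_zero:
  assumes "associative_algebra scale mul" shows "right_ideal scale mul {0}"
proof -
  interpret module scale by (rule associative_algebra_module[OF assms])
  show ?thesis by (auto simp: right_ideal_def associative_algebra_simps[OF assms])
qed

lemma right_ideal_UNIV:
  assumes "associative_algebra scale mul" shows "right_ideal scale mul UNIV"
proof -
  interpret module scale by (rule associative_algebra_module[OF assms])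
  show ?thesis by (auto simp: right_ideal_def)
qed

text \<open>This is \<open>J + v C\<close>, closed since \<open>(v c) a = v (c a)\<close>. Without a
  unit, \<open>v\<close> itself may lie outside it; Kegel's argument exploits exactly this.\<close>

lemma right_ideal_add_multiples:
  assumes alg: "associative_algebra scale mul" and J: "right_ideal scale mul J"
  shows "right_ideal scale mul {j + mul v c | j c. j \<in> J}"
proof -
  interpret module scale by (rule associative_algebra_module[OF alg])
  note alg_simps = associative_algebra_simps[OF alg]
  let ?M = "{j + mul v c | j c. j \<in> J}"
  have sJ: "subspace J" and mJ: "\<And>x a. x \<in> J \<Longrightarrow> mul x a \<in> J"
    using J by (auto simp: right_ideal_def)
  have "subspace ?M"
  proof (rule subspaceI)
    show "0 \<in> ?M" using subspace_0[OF sJ] alg_simps(8)[of v] by force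
  next
    fix x y assume "x \<in> ?M" "y \<in> ?M"
    then obtain j c j' c' where "x = j + mul v c" "j \<in> J" "y = j' + mul v c'" "j' \<in> J" by blast
    then have "x + y = (j + j') + mul v (c + c')" "j + j' \<in> J"
      using subspace_add[OF sJ] by (auto simp: alg_simps)
    then show "x + y \<in> ?M" by blast
  next
    fix x k assume "x \<in> ?M"
    then obtain j c where "x = j + mul v c" "j \<in> J" by blast
    then have "scale k x = scale k j + mul v (scale k c)" "scale k j \<in> J"
      using subspace_scale[OF sJ] by (auto simp: alg_simps scale_right_distrib)
    then show "scale k x \<in> ?M" by blast
  qed
  moreover have "mul x a \<in> ?M" if "x \<in> ?M" for x a
  proof -
    from that obtain j c where "x = j + mul v c" "j \<in> J" by blast
    then have "mul x a = mul j a + mul v (mul c a)" "mul j a \<in> J"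
      using mJ by (auto simp: alg_simps)
    then show ?thesis by blast
  qed
  ultimately show ?thesis by (auto simp: right_ideal_def)
qed

text \<open>Serves to pass from a single \<open>v\<close> with \<open>v C\<close> inside
  \<open>J\<close> to all of \<open>U\<close>: by maximality of \<open>J\<close> this right ideal
  can only be \<open>J\<close> or \<open>U\<close>.\<close>

lemma right_ideal_colon:
  assumes alg: "associative_algebra scale mul"
    and U: "right_ideal scale mul U" and J: "right_ideal scale mul J"
  shows "right_ideal scale mul {w \<in> U. \<forall>c. mul w c \<in> J}"
proof -
  interpret module scale by (rule associative_algebra_module[OF alg])
  note alg_simps = associative_algebra_simps[OF alg]
  have sJ: "subspace J" and sU: "subspace U" and mU: "\<And>x a. x \<in> U \<Longrightarrow> mul x a \<in> U"
    using J U by (auto simp: right_ideal_def)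
  have "subspace {w \<in> U. \<forall>c. mul w c \<in> J}"
  proof (rule subspaceI)
    show "0 \<in> {w \<in> U. \<forall>c. mul w c \<in> J}"
      using subspace_0[OF sJ] subspace_0[OF sU] by (simp add: alg_simps)
  next
    fix x y assume "x \<in> {w \<in> U. \<forall>c. mul w c \<in> J}" "y \<in> {w \<in> U. \<forall>c. mul w c \<in> J}"
    then show "x + y \<in> {w \<in> U. \<forall>c. mul w c \<in> J}"
      using subspace_add[OF sJ] subspace_add[OF sU] by (simp add: alg_simps)
  next
    fix x k assume "x \<in> {w \<in> U. \<forall>c. mul w c \<in> J}"
    then show "scale k x \<in> {w \<in> U. \<forall>c. mul w c \<in> J}"
      using subspace_scale[OF sJ] subspace_scale[OF sU] by (simp add: alg_simps)
  qed
  then show ?thesis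
    by (auto simp: right_ideal_def alg_simps mU)
qed

lemma exists_maximal_right_subideal:
  assumes fd: "finite_dimensional_vector_space scale Basis"
    and alg: "associative_algebra scale mul"
    and U: "right_ideal scale mul U" and nz: "U \<noteq> {0}"
  obtains J where "right_ideal scale mul J" "J \<subset> U"
    "\<And>M. right_ideal scale mul M \<Longrightarrow> J \<subseteq> M \<Longrightarrow> M \<subseteq> U \<Longrightarrow> M = J \<or> M = U"
proof -
  interpret finite_dimensional_vector_space scale Basis by (rule fd)
  let ?P = "\<lambda>J. right_ideal scale mul J \<and> J \<subset> U"
  have "0 \<in> U" using U by (auto simp: right_ideal_def intro: subspace_0)
  then have "?P {0}" using right_ideal_zero[OF alg] nz by auto
  moreover have "\<forall>J. ?P J \<longrightarrow> dim J < Suc dimension"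
    using dim_subset_UNIV by (simp add: less_Suc_eq_le)
  \<comment> \<open>Maximal dimension replaces maximality under inclusion; \<open>{0}\<close> is the
    starting candidate and \<open>Suc dimension\<close> the strict bound.\<close>
  ultimately obtain J where J: "?P J" and max: "\<And>M. ?P M \<Longrightarrow> dim M \<le> dim J"
    using ex_has_greatest_nat[of ?P "{0}" dim "Suc dimension"] by blast
  have "M = J \<or> M = U" if "right_ideal scale mul M" "J \<subseteq> M" "M \<subseteq> U" for M
  proof (cases "M = U")
    case False
    then have "dim M \<le> dim J" using that by (intro max) auto
    then show ?thesis
      using subspace_dim_equal[of J M] J that unfolding right_ideal_def by blast
  qed simp
  then show ?thesis using that[of J] J by blast
qed

section \<open>Nilpotency and Kegel's theorem\<close>

text \<open>Left-normed products span the powers, so spans can be avoided from here on. The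
  \<open>n\<close> factors after \<open>x\<close> match the shifted index of
  \<open>algebra_power\<close>.\<close>

lemma nilpotent_algebra_iff:
  assumes alg: "associative_algebra scale mul"
  shows "nilpotent_algebra scale mul \<longleftrightarrow> (\<exists>n. \<forall>x zs. length zs = n \<longrightarrow> foldl mul x zs = 0)"
proof -
  interpret module scale by (rule associative_algebra_module[OF alg])
  note alg_simps = associative_algebra_simps[OF alg]
  have in_power: "foldl mul x zs \<in> algebra_power scale mul (length zs)" for x zs
    by (induction zs rule: rev_induct) (auto intro: span_base)
  have add: "foldl mul (x + y) zs = foldl mul x zs + foldl mul y zs" for x y zs
    by (induction zs arbitrary: x y) (auto simp: alg_simps)
  have scl: "foldl mul (scale c x) zs = scale c (foldl mul x zs)" for c x zs
    by (induction zs arbitrary: x) (auto simp: alg_simps)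
  have zero: "foldl mul 0 zs = 0" for zs
    by (induction zs) (auto simp: alg_simps)
  show ?thesis
  proof
    assume "nilpotent_algebra scale mul"
    then obtain n where "algebra_power scale mul n = {0}"
      by (auto simp: nilpotent_algebra_def)
    then show "\<exists>n. \<forall>x zs. length zs = n \<longrightarrow> foldl mul x zs = 0"
      using in_power by (metis singletonD)
  next
    assume "\<exists>n. \<forall>x zs. length zs = n \<longrightarrow> foldl mul x zs = 0"
    then obtain N where N: "\<And>x zs. length zs = N \<Longrightarrow> foldl mul x zs = 0" by blast
    \<comment> \<open>Generalised for induction: a generator \<open>mul a b\<close> hands its factor
      \<open>b\<close> over to the list, keeping \<open>n + length zs\<close> constant.\<close>
    have "foldl mul x zs = 0"
      if "x \<in> algebra_power scale mul n" "n + length zs = N" for n x zs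
      using that
    proof (induction n arbitrary: x zs)
      case 0
      then show ?case using N by simp
    next
      case (Suc n)
      have "x \<in> span {mul a b | a b. a \<in> algebra_power scale mul n}"
        using Suc.prems by simp
      then show ?case
      proof (induction rule: span_induct_alt)
        case base
        show ?case by (rule zero)
      next
        case (step c y z)
        then obtain a b where "y = mul a b" "a \<in> algebra_power scale mul n" by blast
        then have "foldl mul y zs = 0"
          using Suc.IH[of a "b # zs"] Suc.prems by simp
        with step show ?case by (simp add: add scl)
      qed
    qed
    then have "algebra_power scale mul N \<subseteq> {0}"
      by (metis add.right_neutral foldl_Nil list.size(3) singletonI subsetI)
    moreover have "0 \<in> algebra_power scale mul N"
      by (cases N) (auto intro: span_zero)
    ultimately show "nilpotent_algebra scale mul"
      by (auto simp: nilpotent_algebra_def)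
  qed
qed

text \<open>The first factor \<open>x\<close> ranges over the whole algebra because the argument
  multiplies elements of right ideals by elements of \<open>N1\<close> or \<open>N2\<close>.\<close>

theorem kegel_nilpotent_sum:
  assumes alg: "associative_algebra scale mul"
    and sum: "\<And>x. \<exists>a\<in>N1. \<exists>b\<in>N2. x = a + b"
    and nil1: "\<And>x zs. set zs \<subseteq> N1 \<Longrightarrow> length zs = n1 \<Longrightarrow> foldl mul x zs = 0"
    and nil2: "\<And>x zs. set zs \<subseteq> N2 \<Longrightarrow> length zs = n2 \<Longrightarrow> foldl mul x zs = 0"
  shows "nilpotent_algebra scale mul"
proof -
  note alg_simps = associative_algebra_simps[OF alg]
  obtain Basis where fd: "finite_dimensional_vector_space scale Basis"
    using alg by (auto simp: associative_algebra_def finite_dimensional_def)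
  interpret finite_dimensional_vector_space scale Basis by (rule fd)
  have "\<exists>m. \<forall>x\<in>U. \<forall>zs. length zs = m \<longrightarrow> foldl mul x zs = 0"
    if "right_ideal scale mul U" for U
    using that
  proof (induction "dim U" arbitrary: U rule: less_induct)
    case less
    note U = less.prems
    show ?case
    proof (cases "U = {0}")
      case True
      then show ?thesis by (intro exI[of _ 0]) auto
    next
      case False
      then obtain J where J: "right_ideal scale mul J" and JU: "J \<subset> U"
        and max: "\<And>M. right_ideal scale mul M \<Longrightarrow> J \<subseteq> M \<Longrightarrow> M \<subseteq> U \<Longrightarrow> M = J \<or> M = U"
        using exists_maximal_right_subideal[OF fd alg U] by metis
      have sJ: "subspace J" and mJ: "\<And>x a. x \<in> J \<Longrightarrow> mul x a \<in> J"
        and sU: "subspace U" and mU: "\<And>x a. x \<in> U \<Longrightarrow> mul x a \<in> U"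
        using J U by (auto simp: right_ideal_def)
      have J0: "0 \<in> J" by (rule subspace_0[OF sJ])
      obtain v where v: "v \<in> U" "v \<notin> J" and vN1: "\<And>a. a \<in> N1 \<Longrightarrow> mul v a \<in> J"
      \<comment> \<open>Otherwise every element of \<open>U - J\<close> has a right multiple by some
        element of \<open>N1\<close> still in \<open>U - J\<close>; after \<open>n1\<close> factors
        the product is 0, which lies in \<open>J\<close>.\<close>
      proof (rule ccontr)
        assume "\<not> thesis"
        then have ex: "\<And>w. w \<in> U \<Longrightarrow> w \<notin> J \<Longrightarrow> \<exists>a\<in>N1. mul w a \<notin> J"
          using that by blast
        obtain x where x: "x \<in> U - J" using JU by blast
        have "\<exists>zs. set zs \<subseteq> N1 \<and> length zs = n \<and> foldl mul x zs \<in> U - J" for n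
        proof (induction n)
          case 0
          show ?case using x by (intro exI[of _ "[]"]) simp
        next
          case (Suc n)
          then obtain zs where zs: "set zs \<subseteq> N1" "length zs = n" "foldl mul x zs \<in> U - J" by blast
          then obtain a where "a \<in> N1" "mul (foldl mul x zs) a \<notin> J" using ex by blast
          with zs mU show ?case by (intro exI[of _ "zs @ [a]"]) auto
        qed
        then obtain zs where "set zs \<subseteq> N1" "length zs = n1" "foldl mul x zs \<notin> J" by blast
        with nil1 J0 show False by metis
      qed
      let ?M = "{j + mul v c | j c. j \<in> J}"
      have "v \<notin> ?M"
      proof
        assume "v \<in> ?M"
        then obtain j c where jc: "v = j + mul v c" "j \<in> J" by blast
        obtain a b where ab: "a \<in> N1" "b \<in> N2" "c = a + b" using sum by blast
        have vb: "v - mul v b \<in> J"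
        proof -
          have "j = v - mul v c" using jc(1) by (metis add_diff_cancel_right')
          then have "v - mul v b = j + mul v a" by (simp add: ab(3) alg_simps)
          then show ?thesis using subspace_add[OF sJ jc(2) vN1[OF ab(1)]] by simp
        qed
        \<comment> \<open>Since \<open>v\<close> and \<open>v b\<close> agree modulo the right ideal
          \<open>J\<close>, so do \<open>v\<close> and \<open>v b^n\<close>; the latter vanishes for
          \<open>n = n2\<close>.\<close>
        have "v - foldl mul v (replicate n b) \<in> J" for n
        proof (induction n)
          case 0
          show ?case using J0 by simp
        next
          case (Suc n)
          let ?w = "foldl mul v (replicate n b)"
          have "v - mul ?w b = (v - mul v b) + mul (v - ?w) b"
            by (simp add: alg_simps)
          then have "v - mul ?w b \<in> J"
            using subspace_add[OF sJ vb mJ[OF Suc.IH, of b]] by (simp only:)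
          moreover have "replicate (Suc n) b = replicate n b @ [b]"
            by (simp add: replicate_append_same)
          ultimately show ?case by (metis foldl_Cons foldl_Nil foldl_append)
        qed
        from this[of n2] have "v \<in> J"
          using nil2[of "replicate n2 b" v] ab(2) by (simp add: set_replicate_conv_if)
        with v(2) show False by simp
      qed
      moreover have "J \<subseteq> ?M"
      proof
        fix j assume "j \<in> J"
        moreover have "j = j + mul v 0" by (simp add: alg_simps)
        ultimately show "j \<in> ?M" by blast
      qed
      moreover have "?M \<subseteq> U"
        using JU mU[OF v(1)] subspace_add[OF sU] by blast
      ultimately have "?M = J"
        using max[OF right_ideal_add_multiples[OF alg J, of v]] v(1) by blast
      moreover have "mul v c \<in> ?M" for c
        using J0 by force
      ultimately have vC: "mul v c \<in> J" for c
        by blast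
      \<comment> \<open>This right ideal contains \<open>J\<close> and also \<open>v\<close>, which
        is not in \<open>J\<close>.\<close>
      have "{w \<in> U. \<forall>c. mul w c \<in> J} = U"
        using max[OF right_ideal_colon[OF alg U J]] JU mJ v vC by blast
      then have UC: "mul w c \<in> J" if "w \<in> U" for w c
        using that by blast
      have "dim J < dim U"
        using JU by (intro dim_psubset) (metis sJ sU span_eq_iff)
      then obtain m where m: "\<And>x zs. x \<in> J \<Longrightarrow> length zs = m \<Longrightarrow> foldl mul x zs = 0"
        using less.hyps[OF _ J] by blast
      \<comment> \<open>The first factor moves \<open>x\<close> into \<open>J\<close>, the other
        \<open>m\<close> annihilate it.\<close>
      have "foldl mul x zs = 0" if "x \<in> U" "length zs = Suc m" for x zs
        using that by (cases zs) (auto intro: m UC)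
      then show ?thesis by blast
    qed
  qed
  from this[OF right_ideal_UNIV[OF alg]] show ?thesis
    by (simp add: nilpotent_algebra_iff[OF alg])
qed

text \<open>A right unit \<open>e\<close> modulo \<open>L\<close> gives \<open>x - x e^k\<close> in
  \<open>L\<close> for all \<open>k\<close>, by telescoping, and \<open>x e^k\<close> vanishes for
  large \<open>k\<close>. The radical is then an empty intersection.\<close>

lemma nilpotent_algebra_jacobson_radical:
  assumes alg: "associative_algebra scale mul" and nil: "nilpotent_algebra scale mul"
  shows "jacobson_radical scale mul = UNIV"
proof -
  interpret module scale by (rule associative_algebra_module[OF alg])
  note alg_simps = associative_algebra_simps[OF alg]
  obtain n where n: "\<And>x zs. length zs = n \<Longrightarrow> foldl mul x zs = 0"
    using nil by (auto simp: nilpotent_algebra_iff[OF alg])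
  have "L = UNIV" if "modular_left_ideal scale mul L" for L
  proof -
    from that obtain e where e: "\<And>x. x - mul x e \<in> L" and s: "subspace L"
      by (auto simp: modular_left_ideal_def left_ideal_def)
    have "x - foldl mul x (replicate k e) \<in> L" for x k
    proof (induction k arbitrary: x)
      case 0
      show ?case using subspace_0[OF s] by simp
    next
      case (Suc k)
      from subspace_add[OF s e[of x] Suc.IH[of "mul x e"]]
      show ?case by simp
    qed
    from this[of _ n] show ?thesis
      using n[of "replicate n e"] by auto
  qed
  then show ?thesis
    by (auto simp: jacobson_radical_def maximal_modular_left_ideal_def)
qed

section \<open>Rota-Baxter operators and the passage from \<open>A_i\<close> to
  \<open>A_(i+1)\<close>\<close>

abbreviation rb_product :: "('v::ab_group_add \<Rightarrow> 'v \<Rightarrow> 'v) \<Rightarrow> ('v \<Rightarrow> 'v) \<Rightarrow> 'v \<Rightarrow> 'v \<Rightarrow> 'v" where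
  "rb_product mul R \<equiv> \<lambda>x y. mul (R x) y + mul x (R y) + mul x y"

lemma rota_baxter_simps:
  assumes "rota_baxter_operator_weight_1 scale mul R"
  shows "R (x + y) = R x + R y" "R (scale c x) = scale c (R x)"
    "mul (R x) (R y) = R (rb_product mul R x y)"
proof -
  have h: "module_hom scale scale R"
    using assms by (simp add: rota_baxter_operator_weight_1_def Vector_Spaces.linear_def)
  show "R (x + y) = R x + R y" "R (scale c x) = scale c (R x)"
    by (rule module_hom.add[OF h] module_hom.scale[OF h])+
  show "mul (R x) (R y) = R (rb_product mul R x y)"
    using assms by (simp add: rota_baxter_operator_weight_1_def)
qed

text \<open>Both bracketings expand to the same seven products of \<open>x\<close>,
  \<open>y\<close>, \<open>z\<close>, with \<open>R\<close> applied to any of the factors but not to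
  all three.\<close>

lemma associative_algebra_rb_product:
  assumes alg: "associative_algebra scale mul"
    and rb: "rota_baxter_operator_weight_1 scale mul R"
  shows "associative_algebra scale (rb_product mul R)"
proof -
  interpret module scale by (rule associative_algebra_module[OF alg])
  note alg_simps = associative_algebra_simps[OF alg]
  note R_add = rota_baxter_simps(1)[OF rb] and R_scale = rota_baxter_simps(2)[OF rb]
  have vs: "vector_space scale"
    using alg by (auto simp: associative_algebra_def finite_dimensional_def
        finite_dimensional_vector_space_def)
  have "bilinear_product scale (rb_product mul R)"
    unfolding bilinear_product_def
    by (auto intro!: Vector_Spaces.linear.intro vs module_hom.intro module_axioms
        module_hom_axioms.intro simp: alg_simps R_add R_scale scale_right_distrib add_ac)
  moreover have "rb_product mul R (rb_product mul R x y) z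
      = rb_product mul R x (rb_product mul R y z)" for x y z
  proof -
    have "rb_product mul R (rb_product mul R x y) z
        = mul (mul (R x) (R y)) z + mul (rb_product mul R x y) (R z) + mul (rb_product mul R x y) z"
      by (simp only: rota_baxter_simps(3)[OF rb])
    also have "\<dots>
        = mul (R x) (rb_product mul R y z) + mul x (mul (R y) (R z)) + mul x (rb_product mul R y z)"
      by (simp only: alg_simps add_ac)
    also have "\<dots> = rb_product mul R x (rb_product mul R y z)"
      by (simp only: rota_baxter_simps(3)[OF rb])
    finally show ?thesis .
  qed
  ultimately show ?thesis
    using alg by (auto simp: associative_algebra_def)
qed

text \<open>Apply the old identity to each of the three summands of the new product of
  \<open>R x\<close> and \<open>R y\<close>, then additivity of \<open>R\<close>.\<close>

lemma rota_baxter_rb_product: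
  assumes rb: "rota_baxter_operator_weight_1 scale mul R"
  shows "rota_baxter_operator_weight_1 scale (rb_product mul R) R"
  using rb rota_baxter_simps(3)[OF rb]
  by (simp add: rota_baxter_operator_weight_1_def rota_baxter_simps(1)[OF rb] add_ac)

lemma nilpotent_algebra_of_rb_product:
  assumes alg: "associative_algebra scale mul"
    and rb: "rota_baxter_operator_weight_1 scale mul R"
    and nil: "nilpotent_algebra scale (rb_product mul R)"
  shows "nilpotent_algebra scale mul"
proof -
  note alg_simps = associative_algebra_simps[OF alg]
  note R_add = rota_baxter_simps(1)[OF rb] and R_mul = rota_baxter_simps(3)[OF rb]
  let ?S = "\<lambda>x. R x + x"
  have h: "module_hom scale scale R"
    using rb by (simp add: rota_baxter_operator_weight_1_def Vector_Spaces.linear_def)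
  obtain n where n: "\<And>x zs. length zs = n \<Longrightarrow> foldl (rb_product mul R) x zs = 0"
    using nil unfolding nilpotent_algebra_iff[OF associative_algebra_rb_product[OF alg rb]] by blast
  have S_mul: "mul (?S x) (?S y) = ?S (rb_product mul R x y)" for x y
    by (simp only: alg_simps R_mul add_ac)
  \<comment> \<open>One factor more than \<open>n\<close>: as \<open>x\<close> need not lie in the
    image of \<open>h\<close>, the first list entry starts the product that is pulled back along
    \<open>h\<close>.\<close>
  have image_nil: "foldl mul x zs = 0"
    if hom: "\<And>x y. mul (h x) (h y) = h (rb_product mul R x y)" and h0: "h 0 = 0"
      and zs: "set zs \<subseteq> range h" "length zs = Suc n" for h x zs
  proof -
    have "\<exists>ys. zs = map h ys"
      unfolding ex_map_conv using zs(1) by blast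
    then obtain ys where ys: "zs = map h ys" by blast
    have fold_hom: "foldl mul (mul x (h y)) (map h ys) = mul x (h (foldl (rb_product mul R) y ys))"
      for y ys
      by (induction ys arbitrary: y) (auto simp: alg_simps(9) hom)
    obtain y ys' where y: "ys = y # ys'" "length ys' = n"
      using zs(2) ys by (cases ys) auto
    have "foldl mul x zs = mul x (h (foldl (rb_product mul R) y ys'))"
      by (simp only: ys y(1) list.map foldl_Cons fold_hom)
    also have "\<dots> = 0"
      by (simp only: n[OF y(2)] h0 alg_simps)
    finally show ?thesis .
  qed
  show ?thesis
  proof (rule kegel_nilpotent_sum[OF alg])
    fix x
    have "x = R (- x) + ?S x"
      by (simp add: module_hom.neg[OF h])
    then show "\<exists>a\<in>range R. \<exists>b\<in>range ?S. x = a + b" by blast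
  next
    show "foldl mul x zs = 0" if "set zs \<subseteq> range R" "length zs = Suc n" for x zs
      using R_mul module_hom.zero[OF h] that by (rule image_nil)
    show "foldl mul x zs = 0" if "set zs \<subseteq> range ?S" "length zs = Suc n" for x zs
      using S_mul _ that by (rule image_nil) (simp add: module_hom.zero[OF h])
  qed
qed

theorem proposition4p14:
  fixes scale :: "'f::alg_closed_field \<Rightarrow> 'v::ab_group_add \<Rightarrow> 'v"
    and mulA mulB succ prec :: "'v \<Rightarrow> 'v \<Rightarrow> 'v"
    and R :: "'v \<Rightarrow> 'v"
  assumes "associative_algebra scale mulA"
    and "associative_algebra scale mulB"
    and "semisimple_algebra scale mulB"
    and "post_associative_structure scale mulA mulB succ prec"
    and "rota_baxter_operator_weight_1 scale mulB R"
    and "\<forall>x y. succ x y = mulB (R x) y"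
    and "\<forall>x y. prec x y = mulB x (R y)"
  shows "\<forall>i. \<not> nilpotent_algebra scale (associated_product mulB R i)"
proof
  fix i
  \<comment> \<open>Proved jointly, since associativity of the next product uses the Rota-Baxter
    identity for the current one.\<close>
  have inv: "associative_algebra scale (associated_product mulB R i)
      \<and> rota_baxter_operator_weight_1 scale (associated_product mulB R i) R" for i
  proof (induction i)
    case 0
    show ?case using assms(2,5) by simp
  next
    case (Suc i)
    then show ?case
      using associative_algebra_rb_product rota_baxter_rb_product by auto
  qed
  show "\<not> nilpotent_algebra scale (associated_product mulB R i)"
  proof (induction i)
    case 0
    show ?case
      using nilpotent_algebra_jacobson_radical[OF assms(2)] assms(3)
      by (auto simp: semisimple_algebra_def)
  next
    case (Suc i)
    then show ?case
      using inv[of i] nilpotent_algebra_of_rb_product by auto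
  qed
qed

end
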